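(* For every $\varepsilon>0$, no online algorithm achieves a competitive ratio of $1.5-\varepsilon$ in the Never-committing model of the One-Fast-Many-Slow problem; i.e., for every online Never-committing scheduler $\mathsf{M}$ there is a Task Arrival Process on which the completion time of $\mathsf{M}$ is greater than $(1.5-\varepsilon)$ times the optimal offline completion time.
   Context: One-Fast-Many-Slow (OFMS) problem. A task is a triple $\tau_i=(f_i,s_i,t_i)$ with $s_i\ge f_i>0$ and $t_i\ge 0$: it needs running time $f_i$ on the single fast machine or $s_i$ on any of infinitely many slow machines, and it arrives (is revealed) at time $t_i$. A Task Arrival Process (TAP) is a finite set of tasks. Each machine runs at most one task at a time and a task cannot start before it arrives. The completion time of a schedule is the earliest time at which all tasks have finished. An online scheduler learns $\tau_i$ only at time $t_i$. In the Never-committing model a scheduler may keep arrived tasks unassigned for any time, and may also interrupt a running task and restart it from scratch on a different machine; the optimal offline algorithm knows the whole TAP in advance. A scheduler achieves competitive ratio $c$ if on every TAP its completion time is at most $c$ times the optimal offline completion time. *)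

theory Defs
  imports Complex_Main "HOL-Library.Extended_Real"
begin

datatype task = Task (fast_time: real) (slow_time: real) (arrival: real)

datatype machine = Fast | Slow nat

definition is_task :: "task \<Rightarrow> bool" where
  "is_task \<tau> \<longleftrightarrow> 0 < fast_time \<tau> \<and> fast_time \<tau> \<le> slow_time \<tau> \<and> 0 \<le> arrival \<tau>"

definition TAP :: "task set \<Rightarrow> bool" where
  "TAP A \<longleftrightarrow> finite A \<and> (\<forall>\<tau>\<in>A. is_task \<tau>)"

fun run_time :: "task \<Rightarrow> machine \<Rightarrow> real" where
  "run_time \<tau> Fast = fast_time \<tau>"
| "run_time \<tau> (Slow _) = slow_time \<tau>"

text \<open>
  A schedule gives, for each task and each point in time, the machine on which the task is being
  run at that time, if any. Leaving an arrived task at \<^const>\<open>None\<close> and changing its machine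
  before it is finished are both permitted, so these are the Never-committing schedules. That a
  task is never run on two machines at once is part of the type.
\<close>

type_synonym schedule = "task \<Rightarrow> real \<Rightarrow> machine option"

definition valid_schedule :: "task set \<Rightarrow> schedule \<Rightarrow> bool" where
  "valid_schedule A \<sigma> \<longleftrightarrow>
     (\<forall>\<tau> x. \<sigma> \<tau> x \<noteq> None \<longrightarrow> \<tau> \<in> A \<and> arrival \<tau> \<le> x) \<and>
     (\<forall>\<tau> \<tau>' x m. \<sigma> \<tau> x = Some m \<and> \<sigma> \<tau>' x = Some m \<longrightarrow> \<tau> = \<tau>')"

text \<open>
  Interrupting a task loses all progress: only one uninterrupted run of full length on a single
  machine, occupying a half-open time interval, finishes it.
\<close>

definition finished_by :: "schedule \<Rightarrow> task \<Rightarrow> real \<Rightarrow> bool" where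
  "finished_by \<sigma> \<tau> x \<longleftrightarrow>
     (\<exists>m a. a + run_time \<tau> m \<le> x \<and> (\<forall>y\<in>{a..<a + run_time \<tau> m}. \<sigma> \<tau> y = Some m))"

text \<open>The value is \<open>\<infinity>\<close> if some task is never finished.\<close>

definition completion_time :: "task set \<Rightarrow> schedule \<Rightarrow> ereal" where
  "completion_time A \<sigma> = (INF x\<in>{x. 0 \<le> x \<and> (\<forall>\<tau>\<in>A. finished_by \<sigma> \<tau> x)}. ereal x)"

definition opt_time :: "task set \<Rightarrow> ereal" where
  "opt_time A = (INF \<sigma>\<in>{\<sigma>. valid_schedule A \<sigma>}. completion_time A \<sigma>)"

definition revealed :: "task set \<Rightarrow> real \<Rightarrow> task set" where
  "revealed A x = {\<tau>\<in>A. arrival \<tau> \<le> x}"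

text \<open>
  A deterministic online scheduler is a non-anticipating map from task arrival processes to
  schedules: what it does up to and including time \<open>x\<close> is determined by the tasks that have
  arrived up to and including time \<open>x\<close>.
\<close>

definition online_scheduler :: "(task set \<Rightarrow> schedule) \<Rightarrow> bool" where
  "online_scheduler M \<longleftrightarrow>
     (\<forall>A. TAP A \<longrightarrow> valid_schedule A (M A)) \<and>
     (\<forall>A B x. TAP A \<and> TAP B \<and> revealed A x = revealed B x \<longrightarrow>
        (\<forall>\<tau>. \<forall>y\<le>x. M A \<tau> y = M B \<tau> y))"

end

theory Submission imports Defs begin

text \<open>
  The adversary releases a task \<open>J = (3, 6)\<close> at time 0 together with tasks that only the fast machine
  can handle in time (slow time 9). As long as the optimum is the one that runs everything on the
  fast machine, \<open>J\<close> must not be left to a slow machine: if the last arrival is at time \<open>t\<close> and the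
  optimum is \<open>4 + 2t/3\<close>, a slow run of \<open>J\<close> started at \<open>t\<close> ends at \<open>6 + t\<close>, which is 3/2 of the
  optimum. So the scheduler has to put \<open>J\<close> on the fast machine at some point, and right after that
  the adversary releases the next task, of a length that makes the optimum \<open>4 + 2t'/3\<close> for the new
  arrival time \<open>t'\<close>. Every slow run of \<open>J\<close> that is still of use now starts after \<open>t'\<close>. Once
  \<open>t' \<ge> 3\<close> up to a small error, the last task is made so long that the fast-only tasks keep the fast
  machine busy until time 6; now it is optimal to run \<open>J\<close> on a slow machine from the start,
  with completion time 6. The scheduler needs time \<open>3 + 6\<close> if it restarts \<open>J\<close> on a slow machine.
  It needs the same time if \<open>J\<close> stays on the fast machine: whenever the fast machine of the optimal
  schedule had to idle before an arrival, the scheduler had not started \<open>J\<close> before that idle period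
  ended, so it loses at least as much time as the optimum does, and the 3 time units for \<open>J\<close> on top.
\<close>

section \<open>Runs of tasks and their disjointness\<close>

definition run :: "schedule \<Rightarrow> task \<Rightarrow> machine \<Rightarrow> real \<Rightarrow> bool" where
  "run \<sigma> \<tau> m a \<longleftrightarrow> (\<forall>y\<in>{a..<a + run_time \<tau> m}. \<sigma> \<tau> y = Some m)"

lemma finished_by_iff_run: "finished_by \<sigma> \<tau> x \<longleftrightarrow> (\<exists>m a. a + run_time \<tau> m \<le> x \<and> run \<sigma> \<tau> m a)"
  by (simp add: finished_by_def run_def)

lemma finished_by_mono: "finished_by \<sigma> \<tau> x \<Longrightarrow> x \<le> y \<Longrightarrow> finished_by \<sigma> \<tau> y"
  unfolding finished_by_def by (meson order_trans)

lemma run_time_pos: "is_task \<tau> \<Longrightarrow> 0 < run_time \<tau> m"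
  by (cases m) (auto simp: is_task_def)

lemma run_start: "run \<sigma> \<tau> m a \<Longrightarrow> is_task \<tau> \<Longrightarrow> \<sigma> \<tau> a = Some m"
  using run_time_pos[of \<tau> m] by (auto simp: run_def)

lemma arrival_le_run:
  assumes "valid_schedule A \<sigma>" "is_task \<tau>" "run \<sigma> \<tau> m a"
  shows "arrival \<tau> \<le> a"
  using run_start[OF assms(3,2)] assms(1) by (auto simp: valid_schedule_def)

lemma runs_disjoint:
  assumes "valid_schedule A \<sigma>" "is_task \<tau>" "is_task \<tau>'" "\<tau> \<noteq> \<tau>'"
    and "run \<sigma> \<tau> m a" "run \<sigma> \<tau>' m a'"
  shows "a + run_time \<tau> m \<le> a' \<or> a' + run_time \<tau>' m \<le> a"
proof (rule ccontr)
  assume "\<not> ?thesis"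
  then have "max a a' \<in> {a..<a + run_time \<tau> m}" "max a a' \<in> {a'..<a' + run_time \<tau>' m}"
    using run_time_pos[OF assms(2), of m] run_time_pos[OF assms(3), of m] by auto
  then have "\<sigma> \<tau> (max a a') = Some m" "\<sigma> \<tau>' (max a a') = Some m"
    using assms(5,6) unfolding run_def by blast+
  then show False using assms(1,4) unfolding valid_schedule_def by blast
qed

text \<open>Remove the interval with the latest start: all others end by that start, so the
  induction hypothesis applies with \<open>X\<close> lowered to it.\<close>

lemma sum_disjoint_intervals_le:
  fixes b l :: "'a \<Rightarrow> real"
  assumes "finite I" and "L \<le> X"
    and "\<And>i. i \<in> I \<Longrightarrow> 0 < l i \<and> L \<le> b i \<and> b i + l i \<le> X"
    and "\<And>i j. i \<in> I \<Longrightarrow> j \<in> I \<Longrightarrow> i \<noteq> j \<Longrightarrow> b i + l i \<le> b j \<or> b j + l j \<le> b i"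
  shows "sum l I \<le> X - L"
  using assms
proof (induction "card I" arbitrary: I X)
  case 0
  then show ?case by simp
next
  case (Suc n)
  have "I \<noteq> {}" using Suc.hyps(2) by auto
  then have "Max (b ` I) \<in> b ` I" using \<open>finite I\<close> by simp
  then obtain k where "k \<in> I" "Max (b ` I) = b k" by blast
  then have k: "k \<in> I" "\<And>i. i \<in> I \<Longrightarrow> b i \<le> b k"
    using \<open>finite I\<close> Max_ge[of "b ` I"] by auto
  have "sum l (I - {k}) \<le> b k - L"
  proof (rule Suc.hyps(1))
    show "n = card (I - {k})" using Suc.hyps(2) k(1) by simp
    show "finite (I - {k})" "L \<le> b k" using Suc.prems k(1) by auto
    show "0 < l i \<and> L \<le> b i \<and> b i + l i \<le> b k" if "i \<in> I - {k}" for i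
      using Suc.prems(3)[of i] Suc.prems(3)[of k] Suc.prems(4)[of i k] k(1) k(2)[of i] that by force
    show "b i + l i \<le> b j \<or> b j + l j \<le> b i" if "i \<in> I - {k}" "j \<in> I - {k}" "i \<noteq> j" for i j
      using Suc.prems(4) that by blast
  qed
  moreover have "sum l I = l k + sum l (I - {k})"
    using Suc.prems(1) k(1) by (simp add: sum.remove)
  ultimately show ?case using Suc.prems(3)[OF k(1)] by linarith
qed

section \<open>Bounds on the optimum and on completion times\<close>

lemma opt_time_le_plan:
  fixes mach :: "task \<Rightarrow> machine" and st :: "task \<Rightarrow> real"
  assumes "0 \<le> X"
    and "\<And>\<tau>. \<tau> \<in> A \<Longrightarrow> arrival \<tau> \<le> st \<tau> \<and> st \<tau> + run_time \<tau> (mach \<tau>) \<le> X"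
    and disj: "\<And>\<tau> \<tau>'. \<tau> \<in> A \<Longrightarrow> \<tau>' \<in> A \<Longrightarrow> \<tau> \<noteq> \<tau>' \<Longrightarrow> mach \<tau> = mach \<tau>' \<Longrightarrow>
      st \<tau> + run_time \<tau> (mach \<tau>) \<le> st \<tau>' \<or> st \<tau>' + run_time \<tau>' (mach \<tau>') \<le> st \<tau>"
  shows "opt_time A \<le> ereal X"
proof -
  define \<sigma> :: schedule where "\<sigma> = (\<lambda>\<tau> y. if \<tau> \<in> A \<and> st \<tau> \<le> y \<and> y < st \<tau> + run_time \<tau> (mach \<tau>)
    then Some (mach \<tau>) else None)"
  have "valid_schedule A \<sigma>"
    unfolding valid_schedule_def
  proof (intro conjI allI impI)
    fix \<tau> x assume "\<sigma> \<tau> x \<noteq> None"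
    then have "\<tau> \<in> A" "st \<tau> \<le> x" by (auto simp: \<sigma>_def split: if_splits)
    then show "\<tau> \<in> A" "arrival \<tau> \<le> x" using assms(2)[of \<tau>] by auto
  next
    fix \<tau> \<tau>' x m assume "\<sigma> \<tau> x = Some m \<and> \<sigma> \<tau>' x = Some m"
    then show "\<tau> = \<tau>'" using disj[of \<tau> \<tau>'] by (force simp: \<sigma>_def split: if_splits)
  qed
  moreover have "finished_by \<sigma> \<tau> X" if "\<tau> \<in> A" for \<tau>
    unfolding finished_by_def using assms(2)[OF that] that
    by (intro exI[of _ "mach \<tau>"] exI[of _ "st \<tau>"]) (auto simp: \<sigma>_def)
  then have "completion_time A \<sigma> \<le> ereal X"
    unfolding completion_time_def using assms(1) by (intro INF_lower) auto
  ultimately show ?thesis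
    unfolding opt_time_def by (meson INF_lower2 mem_Collect_eq)
qed

text \<open>The infimum in \<open>completion_time\<close> might not be attained; the strict
  inequality supplies an actual finishing time below \<open>X\<close>.\<close>

lemma finished_by_of_completion_time_less:
  assumes "completion_time A \<sigma> < ereal X" "\<tau> \<in> A"
  shows "finished_by \<sigma> \<tau> X"
proof -
  obtain x where "\<forall>\<tau>\<in>A. finished_by \<sigma> \<tau> x" "x < X"
    using assms(1) unfolding completion_time_def INF_less_iff by auto
  then show ?thesis using assms(2) finished_by_mono[of \<sigma> \<tau> x X] by auto
qed

lemma opt_time_nonneg: "0 \<le> opt_time A"
  unfolding opt_time_def completion_time_def by (intro INF_greatest) auto

section \<open>The invariant of the adversary\<close>

text \<open>A run of \<open>J\<close> begun before \<open>t\<close> may continue after it, where the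
  scheduler reacts to later tasks, so the invariant speaks about every continuation \<open>B\<close>
  of \<open>A\<close>.\<close>

definition extends_after :: "task set \<Rightarrow> real \<Rightarrow> task set \<Rightarrow> bool" where
  "extends_after A t B \<longleftrightarrow> TAP B \<and> revealed B t = A"

abbreviation J :: task where "J \<equiv> Task 3 6 0"

text \<open>All errors are measured in the unit \<open>d\<close>. The factor 5 exceeds the 4 lost in
  the final state: \<open>3 * d\<close> from stopping at \<open>3 - 3 * d\<close> and
  \<open>d\<close> from the bound on slow starts.\<close>

locale better_than_three_halves =
  fixes M :: "task set \<Rightarrow> schedule" and d :: real
  assumes online: "online_scheduler M"
    and d_pos: "0 < d" and d_less: "d < 1/2"
    and competitive: "\<And>A T \<tau>. TAP A \<Longrightarrow> opt_time A \<le> ereal T \<Longrightarrow> 4 \<le> T \<Longrightarrow> \<tau> \<in> A \<Longrightarrow>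
      finished_by (M A) \<tau> (3/2 * T - 5 * d)"
begin

lemma valid: "TAP A \<Longrightarrow> valid_schedule A (M A)"
  using online by (simp add: online_scheduler_def)

lemma same_before:
  "TAP A \<Longrightarrow> TAP B \<Longrightarrow> revealed A y = revealed B y \<Longrightarrow> M A \<tau> y = M B \<tau> y"
  using online unfolding online_scheduler_def by blast

text \<open>
  Here \<open>t\<close> is the last arrival, \<open>st\<close> a plan that runs the fast-only tasks on the fast machine until
  \<open>E\<close>, and \<open>g\<close> the start of the last busy period of that plan.
\<close>

definition adversary_state :: "task set \<Rightarrow> real \<Rightarrow> real \<Rightarrow> real \<Rightarrow> (task \<Rightarrow> real) \<Rightarrow> bool" where
  "adversary_state A t E g st \<longleftrightarrow>
     TAP A \<and> J \<in> A \<and> 0 \<le> t \<and> t < E \<and> E \<le> 6 \<and> 0 \<le> g \<and> g \<le> t \<and>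
     (\<forall>\<tau>\<in>A. arrival \<tau> \<le> t) \<and>
     (\<forall>\<tau>\<in>A - {J}. slow_time \<tau> = 9 \<and> arrival \<tau> \<le> st \<tau> \<and> st \<tau> + fast_time \<tau> \<le> E) \<and>
     (\<forall>\<tau>\<in>A - {J}. \<forall>\<tau>'\<in>A - {J}. \<tau> \<noteq> \<tau>' \<longrightarrow>
        st \<tau> + fast_time \<tau> \<le> st \<tau>' \<or> st \<tau>' + fast_time \<tau>' \<le> st \<tau>) \<and>
     (\<Sum>\<tau>\<in>{\<tau>\<in>A - {J}. g \<le> arrival \<tau>}. fast_time \<tau>) = E - g \<and>
     (\<forall>B. extends_after A t B \<longrightarrow>
        (\<exists>a. run (M B) J Fast a \<and> a + 3 \<le> t) \<or> (\<forall>n a. run (M B) J (Slow n) a \<longrightarrow> t - d \<le> a)) \<and>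
     (\<forall>B a. extends_after A t B \<longrightarrow> run (M B) J Fast a \<longrightarrow> g - 2 * d \<le> a)"

lemma is_task_J: "is_task J" by (simp add: is_task_def)

lemma extends_after_self: "adversary_state A t E g st \<Longrightarrow> extends_after A t A"
  by (auto simp: adversary_state_def extends_after_def revealed_def)

lemma adversary_state_plan:
  assumes "adversary_state A t E g st" "\<tau> \<in> A" "\<tau> \<noteq> J"
  shows "slow_time \<tau> = 9" "arrival \<tau> \<le> st \<tau>" "st \<tau> + fast_time \<tau> \<le> E"
  using assms unfolding adversary_state_def by blast+

lemma adversary_state_bounds:
  assumes "adversary_state A t E g st"
  shows "0 \<le> t" "t < E" "E \<le> 6" "0 \<le> g" "g \<le> t"
  using assms unfolding adversary_state_def by blast+

lemma opt_time_all_fast: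
  assumes "adversary_state A t E g st"
  shows "opt_time A \<le> ereal (E + 3)"
proof (rule opt_time_le_plan[where mach = "\<lambda>_. Fast" and st = "st(J := E)"])
  show "0 \<le> E + 3" using assms by (simp add: adversary_state_def)
next
  fix \<tau> assume "\<tau> \<in> A"
  then show "arrival \<tau> \<le> (st(J := E)) \<tau> \<and> (st(J := E)) \<tau> + run_time \<tau> Fast \<le> E + 3"
    using adversary_state_plan[OF assms, of \<tau>] adversary_state_bounds[OF assms]
    by (cases "\<tau> = J") auto
next
  fix \<tau> \<tau>' assume "\<tau> \<in> A" "\<tau>' \<in> A" "\<tau> \<noteq> \<tau>'"
  then show "(st(J := E)) \<tau> + run_time \<tau> Fast \<le> (st(J := E)) \<tau>' \<or>
      (st(J := E)) \<tau>' + run_time \<tau>' Fast \<le> (st(J := E)) \<tau>"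
    using assms by (cases "\<tau> = J"; cases "\<tau>' = J") (simp_all add: adversary_state_def)
qed

lemma opt_time_J_slow:
  assumes "adversary_state A t E g st"
  shows "opt_time A \<le> ereal 6"
proof (rule opt_time_le_plan[where mach = "\<lambda>\<tau>. if \<tau> = J then Slow 0 else Fast" and st = "st(J := 0)"])
  fix \<tau> assume "\<tau> \<in> A"
  then show "arrival \<tau> \<le> (st(J := 0)) \<tau> \<and>
      (st(J := 0)) \<tau> + run_time \<tau> (if \<tau> = J then Slow 0 else Fast) \<le> 6"
    using adversary_state_plan[OF assms, of \<tau>] adversary_state_bounds[OF assms]
    by (cases "\<tau> = J") auto
next
  fix \<tau> \<tau>' assume "\<tau> \<in> A" "\<tau>' \<in> A" "\<tau> \<noteq> \<tau>'"
    "(if \<tau> = J then Slow 0 else Fast) = (if \<tau>' = J then Slow 0 else Fast)"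
  then show "(st(J := 0)) \<tau> + run_time \<tau> (if \<tau> = J then Slow 0 else Fast) \<le> (st(J := 0)) \<tau>' \<or>
      (st(J := 0)) \<tau>' + run_time \<tau>' (if \<tau>' = J then Slow 0 else Fast) \<le> (st(J := 0)) \<tau>"
    using assms by (cases "\<tau> = J"; cases "\<tau>' = J") (simp_all add: adversary_state_def)
qed simp

text \<open>A slow run begun at \<open>t - d\<close> or later misses the deadline \<open>X\<close>;
  in the other alternative of the invariant a fast run has ended by \<open>t\<close>.\<close>

lemma adversary_state_fast_run:
  assumes st: "adversary_state A t E g st"
    and fin: "finished_by (M A) J X" and X: "t \<le> X" "X < 6 + t - d"
  obtains a where "run (M A) J Fast a" "a + 3 \<le> X"
proof -
  obtain m a where ma: "run (M A) J m a" "a + run_time J m \<le> X"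
    using fin by (auto simp: finished_by_iff_run)
  show thesis
  proof (cases m)
    case Fast
    then show ?thesis using ma that by simp
  next
    case (Slow n)
    then have "\<not> t - d \<le> a" using ma X by simp
    then obtain a' where "run (M A) J Fast a'" "a' + 3 \<le> t"
      using st extends_after_self[OF st] ma(1) Slow unfolding adversary_state_def by blast
    then show ?thesis using that X(1) by force
  qed
qed

text \<open>No run starts before time 0, which already gives both clauses on runs.\<close>

lemma adversary_state_initial: "adversary_state {J, Task 1 9 0} 0 1 0 (\<lambda>_. 0)"
proof -
  have *: "0 \<le> a" if "extends_after {J, Task 1 9 0} 0 B" "run (M B) J m a" for B m a
    using arrival_le_run[OF valid is_task_J that(2)] that(1) by (simp add: extends_after_def)
  have "{\<tau> \<in> {J, Task 1 9 0} - {J}. 0 \<le> arrival \<tau>} = {Task 1 9 0}" by auto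
  then have "(\<Sum>\<tau>\<in>{\<tau> \<in> {J, Task 1 9 0} - {J}. 0 \<le> arrival \<tau>}. fast_time \<tau>) = 1 - 0"
    by simp
  then show ?thesis
    unfolding adversary_state_def using * d_pos
    by (auto simp: TAP_def is_task_def intro: order_trans[of _ 0])
qed

section \<open>One step of the adversary\<close>

text \<open>The deadline \<open>6 + t - 5 * d\<close> forces a fast run of \<open>J\<close>, and the
  next arrival is placed just after its start. \<open>E'\<close> stays free so that the step serves
  both intermediate states and the last one.\<close>

lemma adversary_step:
  assumes state: "adversary_state A t E g st" and E: "E = 1 + 2/3 * t" and t: "t < 3 - 3 * d"
  obtains t' where "t + d \<le> t'" "t' < 6"
    and "\<And>E'. max E t' < E' \<Longrightarrow> E' \<le> 6 \<Longrightarrow> \<exists>A' g' st'. adversary_state A' t' E' g' st'"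
proof -
  note S = state[unfolded adversary_state_def]
  have A: "TAP A" "J \<in> A" "0 \<le> t" using S by auto
  have arr: "\<And>\<tau>. \<tau> \<in> A \<Longrightarrow> arrival \<tau> \<le> t" using S by auto
  have "finished_by (M A) J (3/2 * (E + 3) - 5 * d)"
    using A E opt_time_all_fast[OF state] by (intro competitive) auto
  then have "finished_by (M A) J (6 + t - 5 * d)" by (simp add: E algebra_simps)
  then obtain a1 where a1: "run (M A) J Fast a1" "a1 + 3 \<le> 6 + t - 5 * d"
    using adversary_state_fast_run[OF state, of "6 + t - 5 * d"] d_pos d_less by auto
  define R where "R = {a. run (M A) J Fast a}"
  have R0: "0 \<le> a" if "a \<in> R" for a
    using arrival_le_run[OF valid[OF A(1)] is_task_J] that by (force simp: R_def)
  have bdd: "bdd_below R" using R0 by (meson bdd_belowI)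
  have "R \<noteq> {}" using a1 by (auto simp: R_def)
  \<comment> \<open>The infimum of \<open>R\<close> might not be attained, so \<open>b\<close> is
    only a start within \<open>d\<close> of it.\<close>
  then obtain b where b: "b \<in> R" "b < Inf R + d"
    using cInf_lessD[of R "Inf R + d"] d_pos by auto
  have b_least: "b - d < a" if "a \<in> R" for a
    using cInf_lower[OF that bdd] b(2) by simp
  have b_le: "b < 3 + t - 4 * d" using b_least[of a1] a1 by (simp add: R_def)
  have run_b: "run (M A) J Fast b" using b by (simp add: R_def)
  define t' where "t' = max b t + d"
  have t': "t + d \<le> t'" "t' < 6" "b < t'" "b + d \<le> t'" using b_le t d_pos by (auto simp: t'_def)
  have "\<exists>A' g' st'. adversary_state A' t' E' g' st'" if E': "max E t' < E'" "E' \<le> 6" for E'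
  proof -
    define s where "s = max E t'"
    define \<tau>' where "\<tau>' = Task (E' - s) 9 t'"
    define A' where "A' = insert \<tau>' A"
    \<comment> \<open>If the plan idles between \<open>E\<close> and \<open>t'\<close>, a new busy
      period begins at \<open>t'\<close>.\<close>
    define g' where "g' = (if E < t' then t' else g)"
    have new: "\<tau>' \<notin> A" "\<tau>' \<noteq> J" using arr[of \<tau>'] t'(1) d_pos A(3) by (auto simp: \<tau>'_def)
    have TAP': "TAP A'"
      using A(1,3) E' t' d_pos by (auto simp: A'_def TAP_def is_task_def \<tau>'_def s_def)
    have rev: "revealed B y = revealed A y" if "extends_after A' t' B" "y < t'" for B y
    proof -
      have "revealed B y = revealed (revealed B t') y" using that(2) by (auto simp: revealed_def)
      also have "\<dots> = revealed A' y" using that(1) by (simp add: extends_after_def)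
      also have "\<dots> = revealed A y" using that(2) by (auto simp: revealed_def A'_def \<tau>'_def)
      finally show ?thesis .
    qed
    have same: "M B J y = M A J y" if "extends_after A' t' B" "y < t'" for B y
      using same_before[of B A y J] rev[OF that] that(1) A(1) by (simp add: extends_after_def)
    have slow': "(\<exists>a. run (M B) J Fast a \<and> a + 3 \<le> t') \<or>
        (\<forall>n a. run (M B) J (Slow n) a \<longrightarrow> t' - d \<le> a)" if B: "extends_after A' t' B" for B
    \<comment> \<open>At time \<open>t' - d = max b t\<close> the fast run from \<open>b\<close> is
      either in progress or over. If in progress, \<open>t' < 6\<close> makes any slow run begun
      earlier cover this moment too.\<close>
    proof (cases "t' - d < b + 3")
      case True
      have "M A J (t' - d) = Some Fast"
        using run_b True t'(4) by (simp add: run_def)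
      then have fast: "M B J (t' - d) = Some Fast" using same[OF B, of "t' - d"] d_pos by simp
      have "t' - d \<le> a" if a: "run (M B) J (Slow n) a" for n a
      proof (rule ccontr)
        assume "\<not> ?thesis"
        moreover have "0 \<le> a"
          using arrival_le_run[OF valid is_task_J a] B by (simp add: extends_after_def)
        ultimately have "M B J (t' - d) = Some (Slow n)"
          using a t'(2) d_pos by (simp add: run_def)
        then show False using fast by simp
      qed
      then show ?thesis by blast
    next
      case False
      then have "run (M B) J Fast b" using run_b same[OF B] d_pos by (auto simp: run_def)
      then show ?thesis using False d_pos by force
    qed
    have start': "g' - 2 * d \<le> a" if B: "extends_after A' t' B" and a: "run (M B) J Fast a" for B a
    proof (cases "E < t'")
      case True
      \<comment> \<open>The threshold \<open>3 - 3 * d\<close> is exactly the condition for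
        \<open>t + d < E\<close>, so \<open>t' = t + d\<close> is excluded here.\<close>
      then have tb: "t' = b + d" using E t by (auto simp: t'_def max_def split: if_splits)
      have "b - d \<le> a"
      proof (rule ccontr)
        assume less: "\<not> ?thesis"
        \<comment> \<open>Before \<open>t'\<close> both schedules agree, and from \<open>t'\<close>
          on the run from \<open>b\<close> covers the rest; spliced together they form a run in
          \<open>M A\<close> that starts too early.\<close>
        have "M A J y = Some Fast" if "a \<le> y" "y < a + 3" for y
        proof (cases "y < t'")
          case True
          then show ?thesis using a same[OF B True] that by (simp add: run_def)
        next
          case False
          then show ?thesis using run_b that less tb d_pos by (simp add: run_def)
        qed
        then have "a \<in> R" by (simp add: R_def run_def)
        then show False using b_least less by force
      qed
      then show ?thesis using True tb by (simp add: g'_def)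
    next
      case False
      \<comment> \<open>Here \<open>g\<close> is unchanged and \<open>B\<close> also continues
        \<open>A\<close>, so the old bound carries over.\<close>
      have "revealed B t = revealed A t" using rev[OF B] t'(1) d_pos by simp
      then have "extends_after A t B"
        using B arr by (auto simp: extends_after_def revealed_def)
      then show ?thesis using S a False by (auto simp: g'_def)
    qed
    have sum': "(\<Sum>\<tau>\<in>{\<tau>\<in>A' - {J}. g' \<le> arrival \<tau>}. fast_time \<tau>) = E' - g'"
    proof (cases "E < t'")
      case True
      then have "{\<tau>\<in>A' - {J}. g' \<le> arrival \<tau>} = {\<tau>'}"
        using new arr t'(1) d_pos by (force simp: A'_def g'_def \<tau>'_def)
      then show ?thesis using True by (simp add: \<tau>'_def s_def g'_def)
    next
      case False
      have "g \<le> t'" using S t'(1) d_pos by linarith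
      then have "{\<tau>\<in>A' - {J}. g' \<le> arrival \<tau>} = insert \<tau>' {\<tau>\<in>A - {J}. g \<le> arrival \<tau>}"
        using new False by (auto simp: A'_def g'_def \<tau>'_def)
      moreover have "finite {\<tau>\<in>A - {J}. g \<le> arrival \<tau>}" using A(1) by (simp add: TAP_def)
      moreover have "(\<Sum>\<tau>\<in>{\<tau>\<in>A - {J}. g \<le> arrival \<tau>}. fast_time \<tau>) = E - g" using S by blast
      ultimately show ?thesis using new False by (simp add: \<tau>'_def s_def g'_def)
    qed
    have plan: "slow_time \<tau> = 9 \<and> arrival \<tau> \<le> (st(\<tau>' := s)) \<tau> \<and> (st(\<tau>' := s)) \<tau> + fast_time \<tau> \<le> E'"
      if "\<tau> \<in> A' - {J}" for \<tau>
    proof (cases "\<tau> = \<tau>'")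
      case True
      then show ?thesis by (simp add: \<tau>'_def s_def)
    next
      case False
      then have "\<tau> \<in> A - {J}" using that by (simp add: A'_def)
      then show ?thesis using adversary_state_plan[OF state, of \<tau>] False E' by simp
    qed
    have old_end: "st \<tau> + fast_time \<tau> \<le> s" if "\<tau> \<in> A - {J}" for \<tau>
      using adversary_state_plan(3)[OF state, of \<tau>] that by (simp add: s_def)
    have disj: "(st(\<tau>' := s)) \<tau>1 + fast_time \<tau>1 \<le> (st(\<tau>' := s)) \<tau>2 \<or>
        (st(\<tau>' := s)) \<tau>2 + fast_time \<tau>2 \<le> (st(\<tau>' := s)) \<tau>1"
      if "\<tau>1 \<in> A' - {J}" "\<tau>2 \<in> A' - {J}" "\<tau>1 \<noteq> \<tau>2" for \<tau>1 \<tau>2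
    proof (cases "\<tau>1 = \<tau>' \<or> \<tau>2 = \<tau>'")
      case True
      then show ?thesis using old_end that by (auto simp: A'_def)
    next
      case False
      then have "\<tau>1 \<in> A - {J}" "\<tau>2 \<in> A - {J}" using that by (auto simp: A'_def)
      then have "st \<tau>1 + fast_time \<tau>1 \<le> st \<tau>2 \<or> st \<tau>2 + fast_time \<tau>2 \<le> st \<tau>1"
        using S that(3) by blast
      then show ?thesis using False by simp
    qed
    have arr': "\<forall>\<tau>\<in>A'. arrival \<tau> \<le> t'" using arr t'(1) d_pos by (force simp: A'_def \<tau>'_def)
    have "J \<in> A'" "0 \<le> t'" "t' < E'" "0 \<le> g'" "g' \<le> t'"
      using S E' t'(1) d_pos by (auto simp: A'_def g'_def)
    then have "adversary_state A' t' E' g' (st(\<tau>' := s))"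
      unfolding adversary_state_def using TAP' arr' plan disj sum' slow' start' E'(2)
      by (intro conjI) blast+
    then show ?thesis by blast
  qed
  then show thesis using that t'(1,2) by blast
qed

text \<open>Each step advances \<open>t\<close> by at least \<open>d\<close>, so a large
  \<open>n\<close> rules out the second alternative.\<close>

lemma adversary_progress:
  "\<exists>A t E g st. adversary_state A t E g st \<and>
     (3 - 3 * d \<le> t \<and> E = 6 \<or> t < 3 - 3 * d \<and> E = 1 + 2/3 * t \<and> real n * d \<le> t)"
proof (induction n)
  case 0
  show ?case using adversary_state_initial d_less by fastforce
next
  case (Suc n)
  then obtain A t E g st where state: "adversary_state A t E g st"
    and or: "3 - 3 * d \<le> t \<and> E = 6 \<or> t < 3 - 3 * d \<and> E = 1 + 2/3 * t \<and> real n * d \<le> t"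
    by blast
  show ?case
  proof (cases "3 - 3 * d \<le> t")
    case True
    then have "3 - 3 * d \<le> t \<and> E = 6" using or by auto
    then show ?thesis using state by blast
  next
    case False
    then have *: "E = 1 + 2/3 * t" "t < 3 - 3 * d" "real n * d \<le> t" using or by auto
    obtain t' where t': "t + d \<le> t'" "t' < 6"
      and next_state: "\<And>E'. max E t' < E' \<Longrightarrow> E' \<le> 6 \<Longrightarrow>
        \<exists>A' g' st'. adversary_state A' t' E' g' st'"
      using adversary_step[OF state *(1,2)] by blast
    show ?thesis
    proof (cases "3 - 3 * d \<le> t'")
      case True
      have "max E t' < 6" using t' * d_pos by simp
      then show ?thesis using next_state[of 6] True by blast
    next
      case False
      \<comment> \<open>\<open>t' < 3\<close> gives \<open>t' < 1 + 2/3 * t'\<close>, which leaves a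
        positive length for the new task.\<close>
      then have "max E t' < 1 + 2/3 * t'" "1 + 2/3 * t' \<le> 6" using t' * d_pos by auto
      moreover have "real (Suc n) * d \<le> t'" using t' * by (simp add: algebra_simps)
      ultimately show ?thesis using next_state[of "1 + 2/3 * t'"] False
        unfolding not_le by blast
    qed
  qed
qed

section \<open>Contradiction in the final state\<close>

text \<open>A volume argument: fast runs of total length \<open>(6 - g) + 3\<close> would have to
  fit between \<open>g - 2 * d\<close> and \<open>9 - 5 * d\<close>, a window shorter by
  \<open>3 * d\<close>.\<close>

lemma no_final_state:
  assumes state: "adversary_state A t 6 g st" and t: "3 - 3 * d \<le> t"
  shows False
proof -
  note S = state[unfolded adversary_state_def]
  define X where "X = 9 - 5 * d"
  have A: "TAP A" "J \<in> A" "t < 6" "0 \<le> g" "g \<le> t" using S by auto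
  have task: "\<And>\<tau>. \<tau> \<in> A \<Longrightarrow> is_task \<tau>" using A(1) by (simp add: TAP_def)
  have fin: "finished_by (M A) \<tau> X" if "\<tau> \<in> A" for \<tau>
    using competitive[OF A(1) opt_time_J_slow[OF state] _ that] by (simp add: X_def)
  obtain aJ where aJ: "run (M A) J Fast aJ" "aJ + 3 \<le> X"
    using adversary_state_fast_run[OF state fin[OF A(2)]] A(3) t d_pos d_less
    by (auto simp: X_def)
  have "g - 2 * d \<le> aJ" using S extends_after_self[OF state] aJ(1) by blast
  define U where "U = {\<tau>\<in>A - {J}. g \<le> arrival \<tau>}"
  have "\<exists>a. run (M A) \<tau> Fast a \<and> a + fast_time \<tau> \<le> X \<and> g \<le> a" if "\<tau> \<in> U" for \<tau>
  proof -
    have \<tau>: "\<tau> \<in> A" "slow_time \<tau> = 9" "g \<le> arrival \<tau>" using that S by (auto simp: U_def)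
    obtain m a where ma: "run (M A) \<tau> m a" "a + run_time \<tau> m \<le> X"
      using fin[OF \<tau>(1)] by (auto simp: finished_by_iff_run)
    have a: "g \<le> a" using arrival_le_run[OF valid[OF A(1)] task[OF \<tau>(1)] ma(1)] \<tau>(3) by simp
    show ?thesis
    proof (cases m)
      case Fast
      then show ?thesis using ma a by auto
    next
      case (Slow n)
      \<comment> \<open>A slow run of length 9 begun at time 0 or later ends after
        \<open>X\<close>.\<close>
      then show ?thesis using ma a A(4) \<tau>(2) d_pos by (simp add: X_def)
    qed
  qed
  then obtain b where b: "\<And>\<tau>. \<tau> \<in> U \<Longrightarrow> run (M A) \<tau> Fast (b \<tau>) \<and> b \<tau> + fast_time \<tau> \<le> X \<and> g \<le> b \<tau>"
    by metis
  define c where "c = b(J := aJ)"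
  have U: "finite U" "J \<notin> U" "U \<subseteq> A" using A(1) by (auto simp: U_def TAP_def)
  have c: "run (M A) \<tau> Fast (c \<tau>)" "c \<tau> + fast_time \<tau> \<le> X" "g - 2 * d \<le> c \<tau>" "\<tau> \<in> A"
    if "\<tau> \<in> insert J U" for \<tau>
    using that b[of \<tau>] aJ \<open>g - 2 * d \<le> aJ\<close> d_pos U A(2) by (auto simp: c_def)
  have "sum fast_time (insert J U) \<le> X - (g - 2 * d)"
  proof (rule sum_disjoint_intervals_le[where b = c])
    show "finite (insert J U)" using U by simp
    show "g - 2 * d \<le> X" using \<open>g - 2 * d \<le> aJ\<close> aJ(2) by simp
    show "0 < fast_time \<tau> \<and> g - 2 * d \<le> c \<tau> \<and> c \<tau> + fast_time \<tau> \<le> X" if "\<tau> \<in> insert J U" for \<tau>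
      using c[OF that] task by (auto simp: is_task_def)
    show "c \<tau> + fast_time \<tau> \<le> c \<tau>' \<or> c \<tau>' + fast_time \<tau>' \<le> c \<tau>"
      if "\<tau> \<in> insert J U" "\<tau>' \<in> insert J U" "\<tau> \<noteq> \<tau>'" for \<tau> \<tau>'
      using runs_disjoint[OF valid[OF A(1)] task[OF c(4)[OF that(1)]] task[OF c(4)[OF that(2)]]
          that(3) c(1)[OF that(1)] c(1)[OF that(2)]] by simp
  qed
  moreover have "sum fast_time U = 6 - g" using S by (simp add: U_def)
  ultimately show False using U d_pos by (simp add: X_def)
qed

lemma contradiction: False
proof -
  obtain n :: nat where n: "3 < real n * d" using d_pos reals_Archimedean3 by blast
  obtain A t E g st where "adversary_state A t E g st"
    "3 - 3 * d \<le> t \<and> E = 6 \<or> t < 3 - 3 * d \<and> E = 1 + 2/3 * t \<and> real n * d \<le> t"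
    using adversary_progress[of n] by blast
  then show False using no_final_state[of A t g st] n d_pos by auto
qed

end

theorem theorem2:
  fixes \<epsilon> :: real and M :: "task set \<Rightarrow> schedule"
  assumes "\<epsilon> > 0" and "online_scheduler M"
  shows "\<exists>A. TAP A \<and> completion_time A (M A) > ereal (3/2 - \<epsilon>) * opt_time A"
proof (rule ccontr)
  assume "\<not> ?thesis"
  then have le: "completion_time A (M A) \<le> ereal (3/2 - \<epsilon>) * opt_time A" if "TAP A" for A
    using that not_le by blast
  \<comment> \<open>The cap keeps the factor \<open>3/2 - e\<close> nonnegative and
    \<open>e / 2\<close> below 1/2.\<close>
  define e where "e = min \<epsilon> (1/2)"
  have e: "0 < e" "e \<le> \<epsilon>" "e \<le> 1/2" using assms(1) by (auto simp: e_def)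
  interpret better_than_three_halves M "e / 2"
  proof
    fix A T \<tau> assume A: "TAP A" "opt_time A \<le> ereal T" "4 \<le> T" "\<tau> \<in> A"
    have "completion_time A (M A) \<le> ereal (3/2 - e) * opt_time A"
      using le[OF A(1)] e ereal_mult_right_mono[OF _ opt_time_nonneg, of "ereal (3/2 - \<epsilon>)" "ereal (3/2 - e)"]
      by (auto intro: order_trans)
    also have "\<dots> \<le> ereal (3/2 - e) * ereal T"
      using A(2) e by (intro ereal_mult_left_mono) auto
    also have "\<dots> = ereal (3/2 * T - e * T)" by (simp add: algebra_simps)
    \<comment> \<open>By \<open>4 \<le> T\<close> the gain \<open>e * T\<close> is at least
      \<open>4 * e\<close>, more than \<open>5 * (e / 2)\<close>.\<close>
    also have "\<dots> < ereal (3/2 * T - 5 * (e / 2))"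
      using mult_left_mono[OF A(3), of e] e by simp
    finally show "finished_by (M A) \<tau> (3/2 * T - 5 * (e / 2))"
      using A(4) by (rule finished_by_of_completion_time_less)
  qed (use assms(2) e in auto)
  show False by (rule contradiction)
qed

end
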